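(* There exist integers $a_1,\ldots,a_{173}$ and integers $n_1,\ldots,n_{173}$, each greater than $1$ and each dividing the odd number $3^3\times 5^2\times 7\times 11\times 13=675675$, such that the system of residue classes $\{a_s(n_s)\}_{s=1}^{173}$ is a cover of $\mathbb{Z}$, and there are distinct primes $p_1,\ldots,p_{173}$, all greater than $5$, such that for each $s\in\{1,\ldots,173\}$ the prime $p_s$ is a primitive prime divisor of $2^{n_s}-1$.
   Context: For $a\in\mathbb{Z}$ and $n\in\mathbb{Z}^+$, $a(n)=\{x\in\mathbb{Z}: x\equiv a \pmod n\}$. A finite system $\{a_s(n_s)\}_{s=1}^k$ of residue classes is a cover of $\mathbb{Z}$ if every integer belongs to at least one of the classes $a_s(n_s)$. For an integer $n>1$, a prime $p$ is a primitive prime divisor of $2^n-1$ if $p\mid 2^n-1$ but $p\nmid 2^m-1$ for every integer $0<m<n$. *)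

theory Defs
  imports "HOL-Number_Theory.Number_Theory"
begin

definition residue_class :: "int \<Rightarrow> nat \<Rightarrow> int set" where
  "residue_class a n = {x. [x = a] (mod int n)}"

text \<open>Systems are indexed families, so repeated moduli and repeated classes are allowed.\<close>

definition is_cover :: "'i set \<Rightarrow> ('i \<Rightarrow> int) \<Rightarrow> ('i \<Rightarrow> nat) \<Rightarrow> bool" where
  "is_cover I a n \<longleftrightarrow> finite I \<and> (\<forall>s\<in>I. n s > 0) \<and>
     (\<forall>x. \<exists>s\<in>I. x \<in> residue_class (a s) (n s))"

definition primitive_prime_divisor :: "nat \<Rightarrow> nat \<Rightarrow> bool" where
  "primitive_prime_divisor p n \<longleftrightarrow> n > 1 \<and> prime p \<and> p dvd 2 ^ n - 1 \<and>
     (\<forall>m. 0 < m \<and> m < n \<longrightarrow> \<not> p dvd 2 ^ m - 1)"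

end

theory Submission
  imports Defs "HOL-Library.Code_Binary_Nat"
begin

text \<open>
  Already \<open>92\<close> residue classes with moduli dividing \<open>51975 = 3^3 \<cdot> 5^2 \<cdot> 7 \<cdot> 11\<close> cover the integers, so the
  issue is to have enough primitive prime divisors for each modulus. No prime has to be exhibited.
  Every prime divisor of a factor \<open>f > 1\<close> of \<open>2^n - 1\<close> that is coprime to all \<open>2^(n div q) - 1\<close>, \<open>q\<close> a
  prime divisor of \<open>n\<close>, is primitive. Moreover, if \<open>N\<close> is a product of known such factors, coprime to
  \<open>(2^n - 1) div N\<close>, and every primitive prime divisor divides \<open>N\<close>, then lifting the exponent shows
  that \<open>2^n - 1\<close> divides \<open>N \<cdot> (\<Prod>q. q \<cdot> (2^(n div q) - 1))\<close>. Since
  \<open>1/3 + 1/5 + 1/7 + 1/11 + 1/13 < 1\<close>, this is too small when \<open>N\<close> is small compared with \<open>n\<close>, which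
  yields one further primitive prime divisor for free.
\<close>

section \<open>Primitive prime divisors\<close>

lemma dvd_two_power_minus_1_iff: "p dvd 2 ^ m - 1 \<longleftrightarrow> ord p 2 dvd m" for p m :: nat
proof -
  have "p dvd 2 ^ m - 1 \<longleftrightarrow> [2 ^ m = 1] (mod p)"
    by (subst cong_altdef_nat) simp_all
  then show ?thesis
    by (simp only: ord_divides)
qed

text \<open>The order \<open>d\<close> of \<open>2\<close> modulo \<open>p\<close> divides
  \<open>n\<close>. If it were a proper divisor, some prime \<open>q\<close> would divide
  \<open>n div d\<close>, so \<open>d\<close> would divide \<open>n div q\<close>, against the last
  assumption.\<close>

lemma primitive_prime_divisorI:
  assumes "n > 1" "prime p" "p dvd 2 ^ n - 1"
    and q: "\<And>q. q \<in> prime_factors n \<Longrightarrow> \<not> p dvd 2 ^ (n div q) - 1"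
  shows "primitive_prime_divisor p n"
proof -
  let ?d = "ord p 2"
  have "?d dvd n"
    using assms(3) by (simp only: dvd_two_power_minus_1_iff)
  then obtain k where k: "n = ?d * k" ..
  have "k = 1"
  proof (rule ccontr)
    assume "k \<noteq> 1"
    then obtain q where "prime q" "q dvd k"
      using prime_factor_nat by blast
    then have "q \<in> prime_factors n" and "?d dvd n div q"
      using k assms(1) by (auto simp: in_prime_factors_iff div_mult_swap[symmetric] intro: gr0I)
    then show False
      using q by (simp only: dvd_two_power_minus_1_iff)
  qed
  then show ?thesis
    using assms k unfolding primitive_prime_divisor_def dvd_two_power_minus_1_iff
    by (auto dest: dvd_imp_le)
qed

text \<open>Both exponents are the least positive \<open>m\<close> with
  \<open>p dvd 2 ^ m - 1\<close>. This makes the sets of primitive prime divisors for different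
  moduli disjoint.\<close>

lemma primitive_prime_divisor_unique:
  assumes "primitive_prime_divisor p n" "primitive_prime_divisor p m"
  shows "n = m"
  using assms unfolding primitive_prime_divisor_def
  by (metis less_trans linorder_neqE_nat zero_less_one)

text \<open>The order of \<open>2\<close> is \<open>2\<close> modulo \<open>3\<close> and
  \<open>4\<close> modulo \<open>5\<close>, both even, while \<open>2 ^ n - 1\<close> is
  odd.\<close>

lemma primitive_prime_divisor_gt_5:
  assumes "primitive_prime_divisor p n" "odd n"
  shows "p > 5"
proof (rule ccontr)
  assume "\<not> p > 5"
  have p: "n > 1" "prime p" "p dvd 2 ^ n - 1" and min: "\<And>m. 0 < m \<Longrightarrow> m < n \<Longrightarrow> \<not> p dvd 2 ^ m - 1"
    using assms(1) by (auto simp: primitive_prime_divisor_def)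
  have "p \<noteq> 0" "p \<noteq> 1" "p \<noteq> 4"
    using p(2) by (auto simp: prime_nat_numeral_eq)
  then consider "p = 2" | "p = 3" | "p = 5"
    using \<open>\<not> p > 5\<close> by linarith
  then show False
  proof cases
    case 1
    then show False
      using p by simp
  next
    case 2
    then have "\<not> 2 < n"
      using min[of 2] by auto
    then have "n = 2"
      using p(1) by simp
    then show False
      using assms(2) by simp
  next
    case 3
    then have "\<not> 4 < n"
      using min[of 4] by auto
    then have "n = 2 \<or> n = 3 \<or> n = 4"
      using p(1) by linarith
    then show False
      using assms(2) p(3) 3 by auto
  qed
qed

lemma finite_primitive_prime_divisors: "finite {p. primitive_prime_divisor p n}"
proof (cases "n > 1")
  case True
  then have "(2::nat) ^ 1 < 2 ^ n"
    by (intro power_strict_increasing) auto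
  then have "finite {p::nat. p dvd 2 ^ n - 1}"
    by (intro finite_divisors_nat) simp
  then show ?thesis
    by (rule rev_finite_subset) (auto simp: primitive_prime_divisor_def)
qed (simp add: primitive_prime_divisor_def)

section \<open>Lifting the exponent\<close>

text \<open>Modulo \<open>q\<^sup>2\<close> the \<open>i\<close>-th power is
  \<open>1 + i * (q * t)\<close>. Summing gives \<open>q\<close> plus \<open>q * t\<close> times the
  triangular number \<open>q * (q - 1) / 2\<close>, which \<open>q\<close> divides because
  \<open>q\<close> is odd.\<close>

lemma cong_sum_powers:
  fixes q t :: nat
  assumes "odd q"
  shows "[(\<Sum>i<q. (1 + q * t) ^ i) = q] (mod q\<^sup>2)"
proof -
  have power: "[(1 + q * t) ^ i = 1 + i * (q * t)] (mod q\<^sup>2)" for i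
  proof (induction i)
    case (Suc i)
    have "[(1 + q * t) ^ Suc i = (1 + q * t) * (1 + i * (q * t))] (mod q\<^sup>2)"
      using cong_mult[OF cong_refl Suc] by (simp only: power_Suc)
    also have "(1 + q * t) * (1 + i * (q * t)) = (1 + Suc i * (q * t)) + q\<^sup>2 * (i * t\<^sup>2)"
      by (simp add: algebra_simps power2_eq_square)
    also have "[\<dots> = 1 + Suc i * (q * t)] (mod q\<^sup>2)"
      by (simp add: cong_def)
    finally show ?case .
  qed simp
  obtain k where k: "q = 2 * k + 1"
    using assms by (rule oddE)
  have "2 * (\<Sum>i<q. i) = q * (2 * k)"
    unfolding k lessThan_Suc_atMost Suc_eq_plus1[symmetric] 
    by (induction k) auto
  then have gauss: "(\<Sum>i<q. i) = q * k"
    by simp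
  have "[(\<Sum>i<q. (1 + q * t) ^ i) = (\<Sum>i<q. 1 + i * (q * t))] (mod q\<^sup>2)"
    by (intro cong_sum power)
  also have "(\<Sum>i<q. 1 + i * (q * t)) = q + q\<^sup>2 * (k * t)"
    by (simp only: sum.distrib sum_distrib_right[symmetric] gauss) (simp add: power2_eq_square)
  also have "[\<dots> = q] (mod q\<^sup>2)"
    by (simp add: cong_def)
  finally show ?thesis .
qed

text \<open>Modulo \<open>p\<close> every power of \<open>y\<close> is \<open>1\<close>, so the sum
  is congruent to \<open>q\<close> and \<open>p\<close> divides it only if \<open>p = q\<close>. In
  that case the congruence modulo \<open>q\<^sup>2\<close> excludes a second factor
  \<open>q\<close>.\<close>

lemma multiplicity_sum_powers_le:
  fixes p q y :: nat
  assumes p: "prime p" and q: "prime q" "odd q" and y: "y > 0" "p dvd y - 1"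
  shows "multiplicity p (\<Sum>i<q. y ^ i) \<le> multiplicity p q"
proof (cases "p = q")
  case True
  from y obtain t where t: "y = 1 + q * t"
    using True by (metis dvdE le_add_diff_inverse less_eq_Suc_le One_nat_def)
  have "\<not> q\<^sup>2 dvd q"
    using q(1) prime_gt_1_nat[OF q(1)] by (auto dest!: dvd_imp_le simp: power2_eq_square)
  then have "\<not> q\<^sup>2 dvd (\<Sum>i<q. y ^ i)"
    using cong_dvd_iff[OF cong_sum_powers[OF q(2), of t]] cong_sum_powers[OF q(2), of t]
    unfolding t cong_def by (metis dvd_eq_mod_eq_0)
  moreover have "(\<Sum>i<q. y ^ i) \<noteq> 0"
    using calculation by (metis dvd_0_right)
  ultimately have "multiplicity q (\<Sum>i<q. y ^ i) < 2"
    using q(1) by (intro multiplicity_lessI) auto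
  moreover have "multiplicity q q = 1"
    using q(1) by (simp add: multiplicity_self)
  ultimately show ?thesis
    using True by simp
next
  case False
  have "[y = 1] (mod p)"
    using y by (subst cong_altdef_nat) auto
  then have "[y ^ i = 1 ^ i] (mod p)" for i
    by (rule cong_pow)
  then have "[(\<Sum>i<q. y ^ i) = (\<Sum>i<q. 1 ^ i)] (mod p)"
    by (intro cong_sum)
  then have "p dvd (\<Sum>i<q. y ^ i) \<longleftrightarrow> p dvd q"
    by (simp add: cong_dvd_iff cong_def dvd_eq_mod_eq_0)
  then have "\<not> p dvd (\<Sum>i<q. y ^ i)"
    using False p q(1) primes_dvd_imp_eq by blast
  then show ?thesis
    by (simp add: not_dvd_imp_multiplicity_0)
qed

section \<open>One further primitive prime divisor from a size bound\<close>

lemma exists_primitive_prime_divisor_not_dvd: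
  fixes n N :: nat
  assumes "n > 1" "odd n"
    and known: "\<And>p. prime p \<Longrightarrow> p dvd N \<Longrightarrow> multiplicity p (2 ^ n - 1) \<le> multiplicity p N"
    and size: "N * \<Prod>(prime_factors n) * 2 ^ (\<Sum>q\<in>prime_factors n. n div q) < 2 ^ n - 1"
    and "N > 0"
  shows "\<exists>p. primitive_prime_divisor p n \<and> \<not> p dvd N"
proof (rule ccontr)
  assume contra: "\<not> ?thesis"
  let ?Q = "prime_factors n"
  let ?B = "\<Prod>q\<in>?Q. q * (2 ^ (n div q) - 1)"
  have pos: "q > 0" "n div q > 0" if "q \<in> ?Q" for q
    using that assms(1) by (auto simp: in_prime_factors_iff div_greater_zero_iff prime_gt_0_nat dvd_imp_le)
  have pos': "q * (2 ^ (n div q) - 1) > 0" if "q \<in> ?Q" for q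
  proof -
    have "(2::nat) ^ (n div q) > 1"
      using pos[OF that] by (intro one_less_power) auto
    then show ?thesis
      using pos[OF that] by simp
  qed
  have B: "?B > 0"
    using pos' by (intro prod_pos) blast
  have "2 ^ n - 1 dvd N * ?B"
  proof (rule multiplicity_le_imp_dvd)
    show "(2::nat) ^ n - 1 \<noteq> 0"
      using assms(1) one_less_power[of "2::nat" n] by simp
    fix p :: nat assume p: "prime p"
    have mult: "multiplicity p (N * ?B) = multiplicity p N + multiplicity p ?B"
      using p B assms(5) by (subst prime_elem_multiplicity_mult_distrib) auto
    show "multiplicity p (2 ^ n - 1) \<le> multiplicity p (N * ?B)"
    proof (cases "p dvd 2 ^ n - 1 \<and> \<not> p dvd N")
      \<comment> \<open>Such a prime is not primitive, so it divides \<open>y - 1\<close> for some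
        \<open>y = 2 ^ (n div q)\<close>. As \<open>2 ^ n - 1 = (y - 1) * T\<close>, and
        \<open>T\<close> contributes to the \<open>p\<close>-part at most what \<open>q\<close>
        does, one factor of \<open>?B\<close> absorbs the whole \<open>p\<close>-part.\<close>
      case True
      then have "\<not> primitive_prime_divisor p n"
        using contra by blast
      then obtain q where q: "q \<in> ?Q" "p dvd 2 ^ (n div q) - 1"
        using primitive_prime_divisorI[OF assms(1) p] True by blast
      define y :: nat where "y = 2 ^ (n div q)"
      have q': "prime q" "odd q" "q dvd n"
        using q(1) assms(2) by (auto simp: in_prime_factors_iff)
      have y1: "y > 1"
        using pos[OF q(1)] unfolding y_def by (intro one_less_power) auto
      define T where "T = (\<Sum>i<q. y ^ i)"
      have T0: "T > 0"
        using y1 pos[OF q(1)] unfolding T_def by (intro sum_pos) auto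
      have "2 ^ n - 1 = y ^ q - 1"
        using q'(3) by (simp add: y_def power_mult[symmetric])
      also have "\<dots> = (y - 1) * T"
      proof -
        have "int (y ^ q - 1) = int ((y - 1) * T)"
          using power_diff_1_eq[of "int y" q] y1 by (simp add: of_nat_diff T_def)
        then show ?thesis by linarith
      qed
      finally have "multiplicity p (2 ^ n - 1) = multiplicity p (y - 1) + multiplicity p T"
        using p y1 T0 by (simp add: prime_elem_multiplicity_mult_distrib)
      also have "\<dots> \<le> multiplicity p (y - 1) + multiplicity p q"
        using multiplicity_sum_powers_le[OF p q'(1,2), of y] q(2) y1 by (simp add: y_def T_def)
      also have "\<dots> = multiplicity p (q * (2 ^ (n div q) - 1))"
        using p y1 pos[OF q(1)] by (simp add: prime_elem_multiplicity_mult_distrib y_def)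
      also have "\<dots> \<le> multiplicity p ?B"
        using B q(1) by (intro dvd_imp_multiplicity_le dvd_prodI) auto
      finally show ?thesis
        unfolding mult by simp
    next
      case False
      then show ?thesis
        using known[OF p] mult by (auto simp: not_dvd_imp_multiplicity_0)
    qed
  qed
  then have "2 ^ n - 1 \<le> N * ?B"
    using B assms(5) by (intro dvd_imp_le) simp_all
  also have "\<dots> \<le> N * (\<Prod>q\<in>?Q. q * 2 ^ (n div q))"
    by (intro mult_left_mono prod_mono) auto
  also have "\<dots> = N * \<Prod>?Q * 2 ^ (\<Sum>q\<in>?Q. n div q)"
    by (simp add: prod.distrib power_sum)
  finally show False
    using size by simp
qed

section \<open>Certified factors of \<open>2 ^ n - 1\<close>\<close>

text \<open>An executable substitute for \<open>prime_factors n\<close>, correct for all divisors of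
  \<open>675675\<close>, whose primes are exactly those listed.\<close>

definition small_prime_divisors :: "nat \<Rightarrow> nat list" where
  "small_prime_divisors n = filter (\<lambda>q. q dvd n) [3, 5, 7, 11, 13]"

text \<open>
  In a certificate \<open>(f, u)\<close> for \<open>n\<close>, the number \<open>u\<close> is an inverse modulo \<open>f\<close> of a product whose factors
  are thereby all coprime to \<open>f\<close>; here \<open>P\<close> is the product of the factors of \<open>2^n - 1\<close> used
  before, and \<open>r div f\<close> is the cofactor \<open>(2^n - 1) div f\<close> reduced modulo \<open>f\<close>.
\<close>

definition certificate :: "nat \<Rightarrow> nat \<Rightarrow> nat \<times> nat \<Rightarrow> bool" where
  "certificate n P = (\<lambda>(f, u). f > 1 \<and> (let r = mod_exp 2 n (f * f) in r mod f = 1 \<and>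
     r div f * P * (\<Prod>q\<leftarrow>small_prime_divisors n. mod_exp 2 (n div q) f - 1) * u mod f = 1))"

fun certificates :: "nat \<Rightarrow> nat \<Rightarrow> (nat \<times> nat) list \<Rightarrow> bool" where
  "certificates n P [] \<longleftrightarrow> True"
| "certificates n P (c # cs) \<longleftrightarrow> certificate n P c \<and> certificates n (P * fst c) cs"

text \<open>
  The summand \<open>1\<close> is the prime divisor that comes for free. Capping the exponent at \<open>100\<close> keeps the
  power evaluable when \<open>n\<close> is large.
\<close>

definition capacity :: "nat \<Rightarrow> nat list \<Rightarrow> nat" where
  "capacity n fs = length fs +
     (if prod_list fs * prod_list (small_prime_divisors n)
           < 2 ^ min 100 (n - 1 - (\<Sum>q\<leftarrow>small_prime_divisors n. n div q)) then 1 else 0)"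

lemma set_small_prime_divisors:
  assumes "n dvd 675675"
  shows "set (small_prime_divisors n) = prime_factors n"
proof -
  have "q \<in> {3, 5, 7, 11, 13}" if "prime q" "q dvd n" for q
  proof -
    have "q dvd 3 ^ 3 * 5 ^ 2 * 7 * 11 * 13"
      using that(2) assms by (auto intro: dvd_trans)
    then have "q dvd 3 \<or> q dvd 5 \<or> q dvd 7 \<or> q dvd 11 \<or> q dvd 13"
      using that(1) by (auto simp only: prime_dvd_mult_iff prime_dvd_power_iff)
    moreover have "prime (3::nat)" "prime (5::nat)" "prime (7::nat)" "prime (11::nat)" "prime (13::nat)"
      by simp_all
    ultimately show ?thesis
      using that(1) primes_dvd_imp_eq by blast
  qed
  moreover have "n \<noteq> 0"
    using assms by (intro notI) simp
  ultimately show ?thesis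
    by (auto simp: small_prime_divisors_def in_prime_factors_iff)
qed

lemma certificateD:
  assumes "certificate n P (f, u)" "n dvd 675675"
  shows "f > 1" "f dvd 2 ^ n - 1" "coprime ((2 ^ n - 1) div f) f" "coprime P f"
    "\<And>q. q \<in> prime_factors n \<Longrightarrow> coprime (2 ^ (n div q) - 1) f"
proof -
  define r where "r = (2::nat) ^ n mod (f * f)"
  define L where "L = map (\<lambda>q. 2 ^ (n div q) mod f - 1) (small_prime_divisors n)"
  have f: "f > 1" and r: "r mod f = 1" and u: "r div f * P * prod_list L * u mod f = 1"
    using assms(1) by (auto simp: certificate_def r_def L_def mod_exp_def Let_def)
  show "f > 1" by fact
  have mod: "2 ^ n mod f = 1"
    using r by (simp add: r_def mod_mod_cancel)
  then show dvd: "f dvd 2 ^ n - 1"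
    by (metis dvd_minus_mod)
  have "coprime (r div f * P * prod_list L * u) f"
    using u f by (metis cong_def coprime_iff_invertible_nat mod_less mult.right_neutral coprime_1_left cong_imp_coprime cong_sym coprime_commute One_nat_def)
  then have *: "coprime (r div f) f" "coprime P f" "coprime (prod_list L) f"
    by auto
  show "coprime P f" by fact
  \<comment> \<open>With cofactor \<open>c\<close>, reducing \<open>f * c + 1\<close> modulo
    \<open>f * f\<close> gives \<open>f * (c mod f) + 1\<close>. Division by \<open>f > 1\<close>
    then recovers \<open>c mod f\<close>.\<close>
  have "(2::nat) ^ n = f * ((2 ^ n - 1) div f) + 1"
    using dvd by simp
  then have "r = (f * ((2 ^ n - 1) div f) + 1) mod (f * f)"
    unfolding r_def by presburger
  also have "\<dots> = f * ((2 ^ n - 1) div f mod f) + 1"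
    using f by (subst mod_mult2_eq) (simp del: add_Suc_right One_nat_def add: div_mult_self4)
  finally have "r div f = (2 ^ n - 1) div f mod f + 1 div f"
    using f by (simp only: div_mult_self4)
  then show "coprime ((2 ^ n - 1) div f) f"
    using *(1) f by simp
  fix q assume "q \<in> prime_factors n"
  then have "q \<in> set (small_prime_divisors n)"
    using set_small_prime_divisors[OF assms(2)] by simp
  then have "(2 ^ (n div q) mod f - 1) dvd prod_list L"
    by (intro prod_list_dvd) (simp add: L_def)
  then have c: "coprime (2 ^ (n div q) mod f - 1) f"
    using *(3) by (meson coprime_divisors dvd_refl)
  \<comment> \<open>Subtraction on naturals truncates: a zero residue would give
    \<open>0 - 1 = 0\<close>, which is not coprime to \<open>f > 1\<close>.\<close>
  then have "2 ^ (n div q) mod f \<noteq> 0"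
    using f by (intro notI) simp
  then have "[2 ^ (n div q) - 1 = 2 ^ (n div q) mod f - 1] (mod f)"
    by (intro cong_diff_nat) (auto simp: cong_def)
  then show "coprime (2 ^ (n div q) - 1) f"
    using c by (metis cong_imp_coprime cong_sym)
qed

text \<open>Coprimality to all \<open>2 ^ (n div q) - 1\<close> makes \<open>p\<close> primitive;
  coprimality to the cofactor puts the whole \<open>p\<close>-part of \<open>2 ^ n - 1\<close> into
  \<open>f\<close>.\<close>

lemma certificate_prime:
  assumes "certificate n P (f, u)" "n dvd 675675" "n > 1" "prime p" "p dvd f"
  shows "primitive_prime_divisor p n" "multiplicity p (2 ^ n - 1) = multiplicity p f"
proof -
  note cert = certificateD[OF assms(1,2)]
  have "p dvd 2 ^ n - 1"
    using assms(5) cert(2) by (rule dvd_trans)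
  moreover have "\<not> p dvd 2 ^ (n div q) - 1" if "q \<in> prime_factors n" for q
    using cert(5)[OF that] assms(4,5) by (meson coprime_common_divisor not_prime_unit)
  ultimately show "primitive_prime_divisor p n"
    using assms(3,4) by (intro primitive_prime_divisorI)
  define c :: nat where "c = (2 ^ n - 1) div f"
  have c: "2 ^ n - 1 = f * c"
    using cert(2) by (simp add: c_def)
  have "\<not> p dvd c"
    using cert(3) assms(4,5) unfolding c_def by (meson coprime_common_divisor not_prime_unit)
  moreover have "c \<noteq> 0"
    using calculation by (intro notI) simp
  ultimately show "multiplicity p (2 ^ n - 1) = multiplicity p f"
    using assms(4) cert(1) unfolding c
    by (subst prime_elem_multiplicity_mult_distrib) (auto simp: not_dvd_imp_multiplicity_0)
qed

lemma prime_dvd_prod_list_iff: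
  "prime p \<Longrightarrow> p dvd prod_list xs \<longleftrightarrow> (\<exists>x\<in>set xs. p dvd x)"
  by (auto simp: prod_mset_prod_list[symmetric] prime_dvd_prod_mset_iff)

lemma certificates_mem:
  assumes "certificates n P cs" "c \<in> set cs"
  shows "\<exists>P'. certificate n P' c"
  using assms by (induction cs arbitrary: P) auto

text \<open>One prime is picked from each factor. Carrying \<open>\<not> p dvd P\<close> through the
  induction keeps later primes from dividing earlier factors, so all of them are distinct.\<close>

lemma certificates_primes:
  assumes "certificates n P cs" "n dvd 675675" "n > 1"
  shows "\<exists>S. finite S \<and> card S = length cs \<and>
    (\<forall>p\<in>S. primitive_prime_divisor p n \<and> \<not> p dvd P \<and> p dvd prod_list (map fst cs))"
  using assms(1)
proof (induction cs arbitrary: P)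
  case Nil
  then show ?case by (intro exI[of _ "{}"]) simp
next
  case (Cons c cs)
  obtain f u where c: "c = (f, u)" by fastforce
  have cert: "certificate n P (f, u)" and rest: "certificates n (P * f) cs"
    using Cons.prems by (auto simp: c)
  obtain S where S: "finite S" "card S = length cs"
    "\<And>p. p \<in> S \<Longrightarrow> primitive_prime_divisor p n \<and> \<not> p dvd P * f \<and> p dvd prod_list (map fst cs)"
    using Cons.IH[OF rest] by blast
  obtain p where p: "prime p" "p dvd f"
    using certificateD(1)[OF cert assms(2)] by (metis less_irrefl prime_factor_nat)
  then have "\<not> p dvd P"
    using certificateD(4)[OF cert assms(2)] by (meson coprime_common_divisor not_prime_unit)
  moreover have "p \<notin> S"
    using S(3) p(2) by (blast intro: dvd_mult)
  ultimately show ?case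
    using S p certificate_prime(1)[OF cert assms(2,3) p]
    by (intro exI[of _ "insert p S"]) (auto simp: c dest: S(3) intro: dvd_mult2)
qed

lemma capacity_le_card:
  assumes cs: "certificates n 1 cs" and n: "n dvd 675675" "n > 1"
  shows "capacity n (map fst cs) \<le> card {p. primitive_prime_divisor p n}"
proof -
  let ?N = "prod_list (map fst cs)" and ?k = "n - 1 - (\<Sum>q\<leftarrow>small_prime_divisors n. n div q)"
  let ?R = "{p. primitive_prime_divisor p n}"
  obtain S where S: "finite S" "card S = length cs"
    "\<And>p. p \<in> S \<Longrightarrow> primitive_prime_divisor p n \<and> p dvd ?N"
    using certificates_primes[OF assms] by blast
  \<comment> \<open>A single factor \<open>f\<close> already carries the full \<open>p\<close>-part,
    and \<open>f dvd ?N\<close> passes it on to the product.\<close>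
  have known: "\<exists>f. f dvd ?N \<and> p dvd f \<and> multiplicity p (2 ^ n - 1) = multiplicity p f"
    if p: "prime p" "p dvd ?N" for p
  proof -
    obtain f u where fu: "(f, u) \<in> set cs" "p dvd f"
      using p by (auto simp: prime_dvd_prod_list_iff)
    moreover obtain P where "certificate n P (f, u)"
      using certificates_mem[OF cs fu(1)] by blast
    moreover have "f dvd ?N"
      using fu(1) by (intro prod_list_dvd) force
    ultimately show ?thesis
      using certificate_prime(2)[OF _ n p(1)] by blast
  qed
  have "f \<noteq> 0" if "(f, u) \<in> set cs" for f u
    using certificates_mem[OF cs that] certificateD(1)[OF _ n(1)] by fastforce
  then have N: "?N > 0"
    by (fastforce simp: prod_list_zero_iff intro!: gr0I)
  have pf: "(\<Sum>q\<leftarrow>small_prime_divisors n. n div q) = (\<Sum>q\<in>prime_factors n. n div q)"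
    "prod_list (small_prime_divisors n) = \<Prod>(prime_factors n)"
    unfolding set_small_prime_divisors[OF n(1), symmetric]
    by (simp_all add: sum_list_distinct_conv_sum_set prod.distinct_set_conv_list small_prime_divisors_def)
  show ?thesis
  proof (cases "?N * prod_list (small_prime_divisors n) < 2 ^ min 100 ?k")
    case True
    have R0: "\<Prod>(prime_factors n) > 0"
      by (intro prod_pos) (auto simp: in_prime_factors_iff prime_gt_0_nat)
    have le: "2 ^ min 100 ?k \<le> (2::nat) ^ ?k"
      by (intro power_increasing) auto
    then have less: "?N * \<Prod>(prime_factors n) < 2 ^ ?k"
      using less_le_trans[OF True le] by (simp add: pf)
    \<comment> \<open>The left side is at least \<open>1\<close>, so \<open>?k\<close> is positive
      and the truncated subtraction defining it was exact.\<close>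
    then have "?k \<noteq> 0"
      using N R0 by (intro notI) simp
    then have k: "?k + (\<Sum>q\<in>prime_factors n. n div q) = n - 1"
      by (simp add: pf)
    have "?N * \<Prod>(prime_factors n) * 2 ^ (\<Sum>q\<in>prime_factors n. n div q)
        < 2 ^ ?k * 2 ^ (\<Sum>q\<in>prime_factors n. n div q)"
      using less by simp
    also have "\<dots> = 2 ^ (n - 1)"
      by (simp only: power_add[symmetric] k)
    \<comment> \<open>The \<open>1\<close> subtracted in \<open>?k\<close> is spent here, on passing
      from \<open>2 ^ n\<close> to \<open>2 ^ n - 1\<close>.\<close>
    also have "\<dots> \<le> 2 ^ n - 1"
      using n(2) by (cases n) auto
    finally have size: "?N * \<Prod>(prime_factors n) * 2 ^ (\<Sum>q\<in>prime_factors n. n div q) < 2 ^ n - 1" .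
    have "odd n"
      using n(1) by (auto dest: dvd_trans)
    then obtain p where p: "primitive_prime_divisor p n" "\<not> p dvd ?N"
      using exists_primitive_prime_divisor_not_dvd[OF n(2) _ _ size N] known N
      by (metis dvd_imp_multiplicity_le less_not_refl2)
    then have "p \<notin> S"
      using S(3) by blast
    then have "capacity n (map fst cs) = card (insert p S)"
      using S True by (simp add: capacity_def)
    also have "\<dots> \<le> card ?R"
      using S p by (intro card_mono finite_primitive_prime_divisors) auto
    finally show ?thesis .
  next
    case False
    then have "capacity n (map fst cs) = card S"
      using S by (simp add: capacity_def)
    also have "\<dots> \<le> card ?R"
      using S by (intro card_mono finite_primitive_prime_divisors) auto
    finally show ?thesis .
  qed
qed

section \<open>Verifying covers\<close>

text \<open>
  A class is encoded by its moduli and residues with respect to pairwise coprime \<open>Ms\<close>. The conditionals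
  below stand for connectives because the simplifier evaluates only conditionals lazily.
\<close>

definition components :: "nat list \<Rightarrow> nat \<times> nat \<Rightarrow> (nat \<times> nat) list" where
  "components Ms = (\<lambda>(n, a). map (\<lambda>M. let g = gcd n M in (g, a mod g)) Ms)"

fun all_trivial :: "(nat \<times> nat) list \<Rightarrow> bool" where
  "all_trivial [] = True"
| "all_trivial ((g, r) # C) = (if g = 1 then all_trivial C else False)"

fun some_trivial :: "(nat \<times> nat) list list \<Rightarrow> bool" where
  "some_trivial [] = False"
| "some_trivial (C # Cs) = (if all_trivial C then True else some_trivial Cs)"

fun residual :: "(nat \<times> nat) list list \<Rightarrow> nat \<Rightarrow> (nat \<times> nat) list list" where
  "residual [] i = []"
| "residual ([] # Cs) i = residual Cs i"
| "residual (((g, r) # C) # Cs) i =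
     (if g = 1 then C # residual Cs i else if i mod g = r then C # residual Cs i else residual Cs i)"

text \<open>A depth-first search through residue vectors. A class whose remaining moduli are all
  \<open>1\<close> matches every branch below, so \<open>some_trivial\<close> can cut the search
  short.\<close>

fun covers :: "nat list \<Rightarrow> (nat \<times> nat) list list \<Rightarrow> bool" where
  "covers [] Cs = some_trivial Cs"
| "covers (M # Ms) Cs =
     (if some_trivial Cs then True else list_all (covers Ms \<circ> residual Cs) [0..<M])"

abbreviation matches :: "nat list \<Rightarrow> (nat \<times> nat) list \<Rightarrow> bool" where
  "matches \<equiv> list_all2 (\<lambda>x (g, r). x mod g = r)"

text \<open>For modulus \<open>1\<close> the bound \<open>r < g\<close> forces \<open>r = 0\<close>,
  which is the residue of every number.\<close>

lemma all_trivial_matches: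
  assumes "all_trivial C" "length xs = length C" "\<forall>(g, r)\<in>set C. r < g"
  shows "matches xs C"
  using assms
proof (induction C arbitrary: xs rule: all_trivial.induct)
  case (2 g r C)
  then show ?case by (cases xs) (auto split: if_splits)
qed simp

lemma some_trivial_iff: "some_trivial Cs \<longleftrightarrow> (\<exists>C\<in>set Cs. all_trivial C)"
  by (induction Cs) auto

lemma residual_matches:
  assumes "C \<in> set (residual Cs x)" "\<forall>C\<in>set Cs. \<forall>(g, r)\<in>set C. r < g"
  shows "\<exists>g r. (g, r) # C \<in> set Cs \<and> x mod g = r"
  using assms
proof (induction Cs x rule: residual.induct)
  case (3 g r D Cs i)
  then show ?case by (auto split: if_splits)
qed auto

text \<open>The vector \<open>xs\<close> selects a branch of the search. A matching residual class
  becomes a matching class of \<open>Cs\<close> once its stripped first component is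
  restored.\<close>

lemma covers_sound:
  assumes "covers Ms Cs" "list_all2 (<) xs Ms"
    and "\<forall>C\<in>set Cs. length C = length Ms \<and> (\<forall>(g, r)\<in>set C. r < g)"
  shows "\<exists>C\<in>set Cs. matches xs C"
  using assms
proof (induction Ms arbitrary: xs Cs)
  case Nil
  then show ?case by (auto simp: some_trivial_iff)
next
  case (Cons M Ms)
  show ?case
  proof (cases "some_trivial Cs")
    case True
    then obtain C where C: "C \<in> set Cs" "all_trivial C"
      by (auto simp: some_trivial_iff)
    have "matches xs C"
      by (rule all_trivial_matches)
         (use C bspec[OF Cons.prems(3) C(1)] list_all2_lengthD[OF Cons.prems(2)] in simp_all)
    then show ?thesis
      using C(1) by blast
  next
    case False
    obtain x ys where xs: "xs = x # ys" "x < M" "list_all2 (<) ys Ms"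
      using Cons.prems(2) by (auto simp: list_all2_Cons2)
    have residual: "\<exists>g r. (g, r) # C \<in> set Cs \<and> x mod g = r" if "C \<in> set (residual Cs x)" for C
      by (rule residual_matches) (use that Cons.prems(3) in blast)+
    have "covers Ms (residual Cs x)"
      using Cons.prems(1) False xs(2) by (simp add: list_all_iff)
    moreover have "\<forall>C\<in>set (residual Cs x). length C = length Ms \<and> (\<forall>(g, r)\<in>set C. r < g)"
      using residual Cons.prems(3) by fastforce
    ultimately obtain C where C: "C \<in> set (residual Cs x)" "matches ys C"
      using Cons.IH[OF _ xs(3)] by blast
    obtain g r where "(g, r) # C \<in> set Cs" "x mod g = r"
      using residual[OF C(1)] by blast
    then show ?thesis
      using C(2) by (intro bexI[of _ "(g, r) # C"]) (simp_all add: xs)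
  qed
qed

text \<open>The Chinese remainder theorem for divisibility: \<open>n\<close> splits as
  \<open>d * e\<close> with \<open>d\<close> dividing \<open>M\<close>, hence
  \<open>gcd n M\<close>, and \<open>e\<close> dividing the product of the other moduli;
  \<open>d\<close> and \<open>e\<close> are coprime.\<close>

lemma dvd_if_gcd_dvd:
  fixes n :: nat and z :: int
  assumes "n dvd prod_list Ms" "sorted_wrt coprime Ms" "\<And>M. M \<in> set Ms \<Longrightarrow> int (gcd n M) dvd z"
  shows "int n dvd z"
  using assms
proof (induction Ms arbitrary: n)
  case (Cons M Ms)
  let ?m = "n div gcd n M"
  have "coprime M (prod_list Ms)"
    using Cons.prems(2) by (auto intro: prod_list_coprime_right)
  obtain d e where de: "n = d * e" "d dvd M" "e dvd prod_list Ms"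
    using Cons.prems(1) by (auto elim: dvd_productE)
  then have cop: "coprime d e"
    using \<open>coprime M (prod_list Ms)\<close> coprime_divisors by blast
  have "int d dvd z"
    using Cons.prems(3)[of M] de by (auto intro: dvd_trans[of "int d" "int (gcd n M)"])
  moreover have "int e dvd z"
  proof (rule Cons.IH)
    show "e dvd prod_list Ms" by fact
    show "sorted_wrt coprime Ms"
      using Cons.prems(2) by simp
    fix M' assume "M' \<in> set Ms"
    then have "int (gcd n M') dvd z"
      using Cons.prems(3) by simp
    moreover have "gcd e M' dvd gcd n M'"
      using de by (auto intro: gcd_mono)
    ultimately show "int (gcd e M') dvd z"
      by (meson dvd_trans int_dvd_int_iff of_nat_dvd_iff)
  qed
  ultimately show ?case
    using cop unfolding de by (simp add: divides_mult)
qed simp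

text \<open>Each integer is replaced by its residues modulo the \<open>Ms\<close>. The class found
  by the search agrees with it modulo every \<open>gcd n M\<close>, and these congruences combine to
  one modulo \<open>n\<close>.\<close>

lemma covers_imp_residue_class:
  assumes cov: "covers Ms (map (components Ms) S)" and cop: "sorted_wrt coprime Ms" and pos: "0 \<notin> set Ms"
    and n: "\<And>n a. (n, a) \<in> set S \<Longrightarrow> n dvd prod_list Ms"
  shows "\<exists>(n, a)\<in>set S. x \<in> residue_class (int a) n"
proof -
  let ?xs = "map (\<lambda>M. nat (x mod int M)) Ms"
  have "list_all2 (<) ?xs Ms"
    using pos by (auto simp: list_all2_conv_all_nth nat_less_iff in_set_conv_nth intro: gr0I)
  moreover have "\<forall>C\<in>set (map (components Ms) S). length C = length Ms \<and> (\<forall>(g, r)\<in>set C. r < g)"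
    using pos by (auto simp: components_def Let_def intro!: mod_less_divisor gr0I)
  ultimately obtain n a where na: "(n, a) \<in> set S"
    and all: "matches ?xs (components Ms (n, a))"
    using covers_sound[OF cov, of ?xs] by auto
  have "int (gcd n M) dvd x - int a" if "M \<in> set Ms" for M
  proof -
    have M: "M > 0"
      using that pos by (auto intro: gr0I)
    have "nat (x mod int M) mod gcd n M = a mod gcd n M"
      using all that by (auto simp: components_def Let_def list_all2_map1 list_all2_map2 list_all2_same)
    then have "int (nat (x mod int M)) mod int (gcd n M) = int a mod int (gcd n M)"
      by (simp only: zmod_int[symmetric])
    then have "x mod int M mod int (gcd n M) = int a mod int (gcd n M)"
      using M by simp
    moreover have "x mod int M mod int (gcd n M) = x mod int (gcd n M)"
      by (intro mod_mod_cancel) (simp only: of_nat_dvd_iff gcd_dvd2)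
    ultimately show ?thesis
      by (simp only: mod_eq_dvd_iff)
  qed
  then have "int n dvd x - int a"
    by (rule dvd_if_gcd_dvd[OF n[OF na] cop])
  then have "x \<in> residue_class (int a) n"
    by (simp add: residue_class_def cong_iff_dvd_diff)
  then show ?thesis
    using na by blast
qed

section \<open>Choosing distinct representatives\<close>

text \<open>As the sets \<open>R n\<close> are pairwise disjoint, injections chosen separately on
  the fibres of \<open>f\<close> glue to an injection on \<open>I\<close>.\<close>

lemma exists_inj_choice:
  fixes R :: "'n \<Rightarrow> 'p set"
  assumes "finite I" "\<And>n. finite (R n)" "\<And>m n. m \<noteq> n \<Longrightarrow> R m \<inter> R n = {}"
    and "\<And>n. n \<in> f ` I \<Longrightarrow> card {i \<in> I. f i = n} \<le> card (R n)"
  shows "\<exists>p. inj_on p I \<and> (\<forall>i\<in>I. p i \<in> R (f i))"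
proof -
  have "\<forall>n\<in>f ` I. \<exists>g. g ` {i \<in> I. f i = n} \<subseteq> R n \<and> inj_on g {i \<in> I. f i = n}"
    using assms by (intro ballI card_le_inj) simp_all
  from bchoice[OF this] obtain g where
    g: "\<forall>n\<in>f ` I. g n ` {i \<in> I. f i = n} \<subseteq> R n \<and> inj_on (g n) {i \<in> I. f i = n}"
    by blast
  let ?p = "\<lambda>i. g (f i) i"
  have R: "?p i \<in> R (f i)" if "i \<in> I" for i
    using g that by blast
  moreover have "inj_on ?p I"
  proof (rule inj_onI)
    fix i j assume ij: "i \<in> I" "j \<in> I" "?p i = ?p j"
    then have "?p i \<in> R (f i) \<inter> R (f j)"
      using R[of i] R[of j] by simp
    then have "f i = f j"
      using assms(3) by blast
    moreover have "inj_on (g (f j)) {i \<in> I. f i = f j}"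
      using g ij(2) by blast
    ultimately show "i = j"
      using ij by (auto dest: inj_onD)
  qed
  ultimately show ?thesis by blast
qed

section \<open>The system of 173 residue classes\<close>

text \<open>
  An entry consists of a modulus \<open>n\<close>, certificates for \<open>n\<close>, and the residues of the classes modulo \<open>n\<close>.
  The classes with \<open>13 dvd n\<close> are not needed for covering; they only fill up the number \<open>173\<close>.
\<close>

definition table :: "(nat \<times> (nat \<times> nat) list \<times> nat list) list" where
  "table =
   [(3, [(7, 1)], [2]),
    (5, [], [2]),
    (7, [], [1]),
    (9, [], [4]),
    (11, [(23, 15)], [5, 8]),
    (13, [], [0]),
    (15, [], [9]),
    (21, [], [12]),
    (25, [(601, 101)], [1, 21]),
    (27, [], [1]),
    (33, [], [15]),
    (35, [(71, 20)], [13, 23]),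
    (39, [(79, 11)], [0, 1]),
    (45, [(631, 251)], [25, 34]),
    (55, [(881, 140), (3191, 2288)], [20, 35, 40]),
    (63, [(92737, 80998)], [10, 19]),
    (65, [], [0]),
    (75, [(100801, 28583)], [6, 66]),
    (77, [], [11]),
    (91, [(911, 603), (112901153, 92885289)], [0, 1, 2]),
    (99, [(199, 157), (153649, 75994)], [1, 45, 91]),
    (105, [(29191, 2274), (106681, 92667), (152041, 137393)], [3, 18, 63]),
    (117, [(937, 330), (6553, 5593), (86113, 79520)], [0, 1, 2, 3]),
    (135, [(271, 17), (348031, 217206)], [43, 88, 133]),
    (143, [(724153, 97780), (158822951431, 84610648628)], [0, 1, 2]),
    (165, [], [105]),
    (175, [(39551, 20626), (60816001, 5812124)], [86, 111, 161]),
    (189, [(1560007, 655704)], [46, 172]),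
    (195, [], [0]),
    (225, [(115201, 57264), (617401, 575985), (1348206751, 360731330)], [16, 61, 106, 181]),
    (231, [(463, 318)], [66, 219]),
    (273, [(108749551, 47879281)], [0, 1]),
    (275, [(382027665134363932751, 256918066233658086584)], [80, 135]),
    (297, [(8950393, 7923768)], [37, 226]),
    (315, [(870031, 17595), (983431, 911422)], [28, 154, 244]),
    (325, [(7151, 7124), (51879585551, 33149066014)], [0, 1, 2]),
    (351, [(446473, 131782), (29121769, 7380796)], [0, 1, 2]),
    (385, [(55441, 52560), (1971764055031, 1286049656057)], [0, 55, 275]),
    (429, [(17286204937, 11216134997)], [0, 1]),
    (455, [(200201, 25308)], [0, 1]),
    (495, [(991, 654)], [210, 375]),
    (525, [(4201, 2493), (7351, 6996), (181165951, 99455625)], [186, 210, 289, 486]),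
    (585, [(2400314671, 2268339697)], [0, 1]),
    (675, [(1605151, 767200)], [91, 316]),
    (693, [(289511839, 21831693)], [87, 604]),
    (715, [], [0]),
    (819, [], [0]),
    (825, [(702948566745151, 369485155856233)], [300, 465]),
    (945, [], [289]),
    (975, [(1951, 1773)], [0, 1]),
    (1001, [(6007, 2063)], [0, 1]),
    (1155, [(2311, 1682)], [615, 1110]),
    (1287, [(216217, 210473), (71477407, 34828492)], [0, 1, 2]),
    (1365, [(469561, 195552)], [0, 1]),
    (1485, [(19694071, 18411381)], [235, 1315]),
    (1575, [(82013401, 4954257)], [919, 1549]),
    (1755, [(1969111, 1908286)], [0, 1]),
    (1925, [(11551, 7688), (13167001, 1283982)], [175, 945, 1330]),
    (2079, [(4159, 1454), (16633, 6458)], [307, 1099, 1693]),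
    (2145, [], [0]),
    (2275, [(218401, 42939)], [0, 1]),
    (2457, [(565111, 550159), (1410319, 254133), (21287449, 14828890), (41194063, 33166753)], [0, 1, 2, 3, 4]),
    (2475, [(4951, 413), (143551, 142689)], [795, 1620, 2445]),
    (2925, [(17551, 1262)], [0, 1]),
    (3003, [], [0]),
    (3465, [(7983361, 5335360)], [1935, 3090]),
    (3575, [], [0]),
    (3861, [], [0]),
    (4095, [], [0]),
    (4725, [], [604]),
    (5005, [], [0]),
    (5775, [], [5565]),
    (6435, [(270271, 184555), (5057911, 3486934)], [0, 1, 2]),
    (6825, [], [0]),
    (7425, [], [7084]),
    (8775, [], [0]),
    (9009, [], [0]),
    (10395, [], [5950]),
    (10725, [(1458601, 636881)], [0, 1]),
    (12285, [], [0]),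
    (15015, [], [0]),
    (17325, [(103951, 43922)], [1234, 13834]),
    (19305, [], [0]),
    (20475, [(1187551, 599862)], [0, 1]),
    (25025, [], [0]),
    (27027, [], [0]),
    (32175, [], [0]),
    (45045, [], [0]),
    (51975, [], [32734]),
    (61425, [], [0]),
    (75075, [(150151, 40351)], [0, 1]),
    (96525, [], [0]),
    (135135, [], [0]),
    (225225, [], [0]),
    (675675, [], [0])]"

definition system :: "(nat \<times> nat) list" where
  "system = concat (map (\<lambda>(n, cs, as). map (Pair n) as) table)"

text \<open>The filter removes the classes with \<open>13 dvd n\<close>; the prime powers of
  \<open>51975\<close> remain as the coprime moduli of the search.\<close>

lemma covers_system:
  "covers [27, 25, 7, 11] (map (components [27, 25, 7, 11]) (filter (\<lambda>(n, a). n dvd 51975) system))"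
  by code_simp

lemma distinct_moduli: "distinct (map fst table)"
  by code_simp

lemma distinct_system: "distinct system"
  by code_simp

lemma length_system: "length system = 173"
  by code_simp

lemma table_moduli:
  "list_all (\<lambda>(n, cs, as). 1 < n \<and> n dvd 675675 \<and> length as \<le> capacity n (map fst cs)) table"
  by code_simp

lemma certificates_table: "list_all (\<lambda>(n, cs, as). certificates n 1 cs) table"
  by code_simp

lemma table_entry:
  assumes "(n, cs, as) \<in> set table"
  shows "n > 1" "n dvd 675675" "certificates n 1 cs" "length as \<le> capacity n (map fst cs)"
  using table_moduli certificates_table assms by (auto simp: list_all_iff)

lemma system_entry:
  assumes "(n, a) \<in> set system"
  obtains cs as where "(n, cs, as) \<in> set table" "a \<in> set as"
  using assms by (auto simp: system_def)

text \<open>Distinct moduli in \<open>table\<close> mean that all classes modulo \<open>n\<close>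
  come from a single entry, whose number of residues is bounded by its capacity.\<close>

lemma card_system_fibre:
  assumes "n \<in> fst ` set system"
  shows "card {i \<in> set system. fst i = n} \<le> card {p. primitive_prime_divisor p n}"
proof -
  from assms obtain a where "(n, a) \<in> set system"
    by auto
  then obtain cs as where entry: "(n, cs, as) \<in> set table"
    by (rule system_entry)
  have "{i \<in> set system. fst i = n} \<subseteq> Pair n ` set as"
    using eq_key_imp_eq_value[OF distinct_moduli entry] by (auto elim!: system_entry)
  then have "card {i \<in> set system. fst i = n} \<le> card (Pair n ` set as)"
    by (intro card_mono) auto
  also have "\<dots> \<le> length as"
    using card_image_le[of "set as" "Pair n"] card_length[of as] by simp
  also have "\<dots> \<le> card {p. primitive_prime_divisor p n}"
    using table_entry[OF entry] capacity_le_card[of n cs] by simp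
  finally show ?thesis .
qed

lemma system_covers: "\<exists>i\<in>set system. x \<in> residue_class (int (snd i)) (fst i)"
proof -
  have "sorted_wrt coprime [27, 25, 7, 11 :: nat]"
    by code_simp
  then have "\<exists>(n, a)\<in>set (filter (\<lambda>(n, a). n dvd 51975) system). x \<in> residue_class (int a) n"
    by (intro covers_imp_residue_class[OF covers_system]) auto
  then show ?thesis
    by force
qed

theorem theorem1p1:
  shows "\<exists>(a :: nat \<Rightarrow> int) (n :: nat \<Rightarrow> nat).
    (\<forall>s\<in>{1..173}. n s > 1 \<and> n s dvd 3 ^ 3 * 5 ^ 2 * 7 * 11 * 13) \<and>
    is_cover {1..173} a n \<and>
    (\<exists>p :: nat \<Rightarrow> nat. inj_on p {1..173} \<and>
      (\<forall>s\<in>{1..173}. prime (p s) \<and> p s > 5 \<and> primitive_prime_divisor (p s) (n s)))"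
proof -
  have "card (set system) = 173"
    by (simp add: distinct_card distinct_system length_system)
  then obtain h :: "nat \<Rightarrow> nat \<times> nat" where h: "bij_betw h {1..173} (set system)"
    using ex_bij_betw_nat_finite_1[of "set system"] by auto
  \<comment> \<open>The primes are attached to the pairs \<open>(n, a)\<close> themselves and
    carried over to the indices by \<open>h\<close> afterwards.\<close>
  have "\<exists>p. inj_on p (set system) \<and> (\<forall>i\<in>set system. p i \<in> {p. primitive_prime_divisor p (fst i)})"
  proof (rule exists_inj_choice[where R = "\<lambda>n. {p. primitive_prime_divisor p n}"])
    show "{p. primitive_prime_divisor p m} \<inter> {p. primitive_prime_divisor p n} = {}"
      if "m \<noteq> n" for m n
      using that primitive_prime_divisor_unique by blast
  qed (simp_all add: finite_primitive_prime_divisors card_system_fibre)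
  then obtain p where p: "inj_on p (set system)"
    "\<And>i. i \<in> set system \<Longrightarrow> primitive_prime_divisor (p i) (fst i)"
    by blast
  have mem: "h s \<in> set system" if "s \<in> {1..173}" for s
    using bij_betwE[OF h] that by blast
  have modulus: "fst i > 1 \<and> fst i dvd 675675" if "i \<in> set system" for i
  proof -
    have "(fst i, snd i) \<in> set system"
      using that by simp
    then show ?thesis
      by (rule system_entry) (use table_entry in blast)
  qed
  show ?thesis
  proof (rule exI[of _ "\<lambda>s. int (snd (h s))"], rule exI[of _ "\<lambda>s. fst (h s)"],
      intro conjI ballI exI[of _ "p \<circ> h"])
    fix s :: nat assume s: "s \<in> {1..173}"
    show "fst (h s) > 1" "fst (h s) dvd 3 ^ 3 * 5 ^ 2 * 7 * 11 * 13"
      using modulus[OF mem[OF s]] by simp_all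
    show prim: "primitive_prime_divisor ((p \<circ> h) s) (fst (h s))"
      using p(2)[OF mem[OF s]] by simp
    then show "prime ((p \<circ> h) s)"
      by (simp add: primitive_prime_divisor_def)
    have "odd (fst (h s))"
      using modulus[OF mem[OF s]] by (auto dest: dvd_trans)
    with prim show "(p \<circ> h) s > 5"
      by (rule primitive_prime_divisor_gt_5)
  next
    show "is_cover {1..173} (\<lambda>s. int (snd (h s))) (\<lambda>s. fst (h s))"
      unfolding is_cover_def
    proof (intro conjI ballI allI)
      fix s :: nat assume "s \<in> {1..173}"
      then show "fst (h s) > 0"
        using modulus[OF mem] by fastforce
    next
      fix x
      obtain i where "i \<in> h ` {1..173}" "x \<in> residue_class (int (snd i)) (fst i)"
        using system_covers[of x] bij_betw_imp_surj_on[OF h] by blast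
      then show "\<exists>s\<in>{1..173}. x \<in> residue_class (int (snd (h s))) (fst (h s))"
        by blast
    qed simp
  next
    show "inj_on (p \<circ> h) {1..173}"
      using h p(1) by (simp add: bij_betw_def comp_inj_on)
  qed
qed

end
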